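(* Let $k\in\mathbb{N}$, $m_1,\dots,m_k\in\mathbb{N}$, $b_1,\dots,b_k\in\mathbb{R}\setminus\{0\}$ and $n\in\mathbb{N}$. Put $B_0=1$ and $B_i=b_1b_2\cdots b_i$ for $1\le i\le k$. Define $G_0(t)=t^n-1$ and, recursively for $i=1,\dots,k$, $$f_{i,1}(t)=\frac{G_{i-1}(t)}{t-B_{i-1}},\qquad f_{i,r}(t)=\frac1t\int_0^t f_{i,r-1}(y)\,dy\quad(2\le r\le m_i),\qquad G_i(t)=\int_{B_i}^{t} f_{i,m_i}(y)\,dy .$$ Then $$S_{m_1,m_2,\dots,m_k}(b_1,b_2,\dots,b_k;n)=\int_0^{b_1b_2\cdots b_k} f_{k,m_k}(t)\,dt .$$ That is, $S_{m_1,\dots,m_k}(b_1,\dots,b_k;n)$ equals the iterated integral $$\int_0^{B_k}\frac{dx_k^{m_k}}{x_k^{m_k}}\int_0^{x_k^{m_k}}\frac{dx_k^{m_k-1}}{x_k^{m_k-1}}\cdots\int_0^{x_k^2}\frac{dx_k^1}{x_k^1-B_{k-1}}\int_{B_{k-1}}^{x_k^1}\frac{dx_{k-1}^{m_{k-1}}}{x_{k-1}^{m_{k-1}}}\cdots\int_0^{x_{k-1}^2}\frac{dx_{k-1}^1}{x_{k-1}^1-B_{k-2}}\cdots\int_{B_1}^{x_2^1}\frac{dx_1^{m_1}}{x_1^{m_1}}\cdots\int_0^{x_1^2}\frac{(x_1^1)^n-1}{x_1^1-1}\,dx_1^1,$$ where superscripts on the integration variables are labels (the exponent $n$ is a pow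er).
   Context: S-sums: for $a_i\in\mathbb{N}=\{1,2,\dots\}$ and $x_i\in\mathbb{R}\setminus\{0\}$, $$S_{a_1,\dots,a_k}(x_1,\dots,x_k;n)=\sum_{n\ge i_1\ge i_2\ge\cdots\ge i_k\ge1}\frac{x_1^{i_1}}{i_1^{a_1}}\cdots\frac{x_k^{i_k}}{i_k^{a_k}} .$$ All integrands are understood as extended continuously across their removable singularities (at $t=B_{i-1}$, where $G_{i-1}(B_{i-1})=0$, and at $t=0$). Integrals $\int_u^v$ are oriented ($\int_u^v=-\int_v^u$). If $m_i=1$, the block for index $i$ consists of the single integration $\frac{dx_i^1}{x_i^1-B_{i-1}}$ with the outer limits of that block. *)

theory Defs
  imports "HOL-Analysis.Analysis" "HOL-Library.FuncSet"
begin

text \<open>Finite families \<open>a\<^sub>1, \<dots>, a\<^sub>k\<close> are functions on \<^typ>\<open>nat\<close> of which only the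
  values at \<open>1, \<dots>, k\<close> are used.\<close>

definition S_sum :: "nat \<Rightarrow> (nat \<Rightarrow> nat) \<Rightarrow> (nat \<Rightarrow> real) \<Rightarrow> nat \<Rightarrow> real" where
  "S_sum k a x n =
     (\<Sum>i \<in> {i \<in> {1..k} \<rightarrow>\<^sub>E {1..n}. \<forall>j\<in>{1..<k}. i (Suc j) \<le> i j}.
        \<Prod>j = 1..k. x j ^ i j / real (i j) ^ a j)"

definition partial_prod :: "(nat \<Rightarrow> real) \<Rightarrow> nat \<Rightarrow> real" where
  "partial_prod b i = (\<Prod>j = 1..i. b j)"

text \<open>The extension of \<open>h\<close> across a removable singularity at \<open>c\<close>: the value at \<open>c\<close> is replaced by
  the limit of \<open>h\<close> at \<open>c\<close>.\<close>

definition cont_ext :: "real \<Rightarrow> (real \<Rightarrow> real) \<Rightarrow> real \<Rightarrow> real" where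
  "cont_ext c h = h(c := Lim (at c) h)"

text \<open>\<open>S_outer n m b i\<close> is \<open>G\<^sub>i\<close> and \<open>S_integrand n m b i r\<close> is \<open>f\<^sub>i\<^sub>,\<^sub>r\<close>. The latter is specified
  only for \<open>i \<ge> 1\<close> and \<open>r \<ge> 1\<close>. The interval integral \<open>LBINT y=u..v. h y\<close> is oriented.\<close>

fun S_outer :: "nat \<Rightarrow> (nat \<Rightarrow> nat) \<Rightarrow> (nat \<Rightarrow> real) \<Rightarrow> nat \<Rightarrow> real \<Rightarrow> real"
  and S_integrand :: "nat \<Rightarrow> (nat \<Rightarrow> nat) \<Rightarrow> (nat \<Rightarrow> real) \<Rightarrow> nat \<Rightarrow> nat \<Rightarrow> real \<Rightarrow> real" where
  "S_outer n m b 0 = (\<lambda>t. t ^ n - 1)"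
| "S_outer n m b (Suc i) =
     (\<lambda>t. LBINT y=ereal (partial_prod b (Suc i))..ereal t. S_integrand n m b (Suc i) (m (Suc i)) y)"
| "S_integrand n m b (Suc i) (Suc 0) =
     cont_ext (partial_prod b i) (\<lambda>t. S_outer n m b i t / (t - partial_prod b i))"
| "S_integrand n m b (Suc i) (Suc (Suc r)) =
     cont_ext 0 (\<lambda>t. 1 / t * (LBINT y=ereal 0..ereal t. S_integrand n m b (Suc i) (Suc r) y))"

text \<open>Nested integrals are described by the list, from the outermost to the innermost integration,
  of pairs \<open>(l, c)\<close> standing for integration against \<open>dx / (x - c)\<close> with lower limit \<open>l\<close>. The upper
  limit is the variable of the next outer integration, or \<open>v\<close> for the outermost one. The
  innermost numerator is \<open>x\<^sup>n - 1\<close>.\<close>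

primrec nested_integral :: "nat \<Rightarrow> (real \<times> real) list \<Rightarrow> real \<Rightarrow> real" where
  "nested_integral n [] = (\<lambda>v. v ^ n - 1)"
| "nested_integral n (p # ps) =
     (\<lambda>v. LBINT x=ereal (fst p)..ereal v.
        cont_ext (snd p) (\<lambda>x. nested_integral n ps x / (x - snd p)) x)"

text \<open>A block of \<open>r \<ge> 1\<close> integrations: \<open>r - 1\<close> of them against \<open>dx / x\<close> and then one against
  \<open>dx / (x - c)\<close>. The outermost one has lower limit \<open>l\<close>, the others lower limit \<open>0\<close>.\<close>

definition integral_block :: "real \<Rightarrow> real \<Rightarrow> nat \<Rightarrow> (real \<times> real) list" where
  "integral_block l c r = zip (l # replicate (r - 1) 0) (replicate (r - 1) 0 @ [c])"

text \<open>The blocks \<open>k, k - 1, \<dots>, 1\<close>, from the outermost to the innermost.\<close>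

definition S_blocks :: "nat \<Rightarrow> (nat \<Rightarrow> nat) \<Rightarrow> (nat \<Rightarrow> real) \<Rightarrow> (real \<times> real) list" where
  "S_blocks k m b =
     concat (map (\<lambda>i. integral_block (if i = k then 0 else partial_prod b i)
                        (partial_prod b (i - 1)) (m i))
       (rev [1..<Suc k]))"

end

theory Submission imports Defs begin

text \<open>All integrands are polynomials. Writing \<open>U\<^sub>i(l)\<close> for the part of the S-sum
  \<open>S\<^bsub>m\<^sub>1,\<dots>,m\<^sub>i\<^esub>(b\<^sub>1, \<dots>, b\<^sub>i; n)\<close> in which all summation indices are at least \<open>l\<close>,
  one has \<open>f\<^bsub>i+1,r\<^esub>(t) = (\<Sum>l=1..n. U\<^sub>i(l) / B\<^sub>i\<^sup>l * t\<^bsup>l-1\<^esup> / l\<^bsup>r-1\<^esup>)\<close>: integration divides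
  the coefficients by \<open>l\<close>, and dividing \<open>t\<^sup>l - B\<^sub>i\<^sup>l\<close> by \<open>t - B\<^sub>i\<close> performs the summation over the
  next index. Integrating from \<open>0\<close> to \<open>B\<^sub>k\<close> gives \<open>U\<^sub>k(1)\<close>.\<close>

section \<open>Index chains and the recursion for S-sums\<close>

primrec S_tail :: "nat \<Rightarrow> (nat \<Rightarrow> nat) \<Rightarrow> (nat \<Rightarrow> real) \<Rightarrow> nat \<Rightarrow> nat \<Rightarrow> real" where
  "S_tail n a x 0 l = 1"
| "S_tail n a x (Suc k) l = (\<Sum>j = l..n. x (Suc k) ^ j / real j ^ a (Suc k) * S_tail n a x k j)"

text \<open>Chains decrease weakly, so a lower bound \<open>l\<close> on the last index bounds all
  of them. The guard \<open>k \<ge> 1\<close> keeps the empty chain, for which \<open>i 0\<close> is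
  \<open>undefined\<close>.\<close>

definition index_chains :: "nat \<Rightarrow> nat \<Rightarrow> nat \<Rightarrow> (nat \<Rightarrow> nat) set" where
  "index_chains n k l = {i \<in> {1..k} \<rightarrow>\<^sub>E {1..n}.
     (\<forall>j\<in>{1..<k}. i (Suc j) \<le> i j) \<and> (k \<ge> 1 \<longrightarrow> l \<le> i k)}"

lemma chains_0: "index_chains n 0 l = {\<lambda>_. undefined}"
  by (auto simp: index_chains_def)

lemma finite_chains: "finite (index_chains n k l)"
  unfolding index_chains_def by (rule finite_subset[of _ "{1..k} \<rightarrow>\<^sub>E {1..n}"]) (auto intro: finite_PiE)

text \<open>One direction of the bijection in \<open>sum_chains\<close>: the value split off becomes
  the lower bound for the remaining chain.\<close>

lemma restrict_mem_chains:
  assumes "i \<in> index_chains n (Suc k) l"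
  shows "restrict i {1..k} \<in> index_chains n k (i (Suc k))"
proof -
  have "i (Suc k) \<le> i k" if "k \<ge> 1"
    using assms that by (auto simp: index_chains_def)
  moreover have "i j \<in> {1..n}" if "j \<in> {1..k}" for j
    using assms that by (auto simp: index_chains_def PiE_def Pi_def)
  moreover have "i (Suc j) \<le> i j" if "j \<in> {1..<k}" for j
    using assms that by (auto simp: index_chains_def)
  ultimately show ?thesis
    by (auto simp: index_chains_def)
qed

text \<open>The inverse direction, where \<open>l \<ge> 1\<close> keeps the new value
  \<open>j\<close> inside \<open>{1..n}\<close>.\<close>

lemma fun_upd_mem_chains:
  assumes "g \<in> index_chains n k j" "j \<in> {l..n}" "l \<ge> 1"
  shows "g(Suc k := j) \<in> index_chains n (Suc k) l"
proof -
  have "g(Suc k := j) \<in> {1..Suc k} \<rightarrow>\<^sub>E {1..n}"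
    using assms by (auto simp: index_chains_def PiE_def Pi_def extensional_def)
  moreover have "(g(Suc k := j)) (Suc q) \<le> (g(Suc k := j)) q" if "q \<in> {1..<Suc k}" for q
    using assms that by (cases "q = k") (auto simp: index_chains_def)
  ultimately show ?thesis
    using assms by (simp add: index_chains_def)
qed

text \<open>\<open>S_tail\<close> unfolds from the last and smallest index: fibring the chains over
  its value \<open>j\<close> leaves shorter chains bounded below by \<open>j\<close>.\<close>

lemma sum_chains:
  assumes "l \<ge> 1"
  shows "(\<Sum>i \<in> index_chains n k l. \<Prod>j = 1..k. x j ^ i j / real (i j) ^ a j) = S_tail n a x k l"
  using assms
proof (induction k arbitrary: l)
  case 0
  show ?case by (simp add: chains_0)
next
  case (Suc k)
  let ?w = "\<lambda>k i. \<Prod>j = 1..k. x j ^ i j / real (i j) ^ a j"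
  let ?y = "\<lambda>j. x (Suc k) ^ j / real j ^ a (Suc k)"
  have "(\<Sum>i \<in> index_chains n (Suc k) l. ?w (Suc k) i)
      = (\<Sum>(j, g) \<in> Sigma {l..n} (index_chains n k). ?y j * ?w k g)"
  proof (rule sum.reindex_bij_witness
      [where j = "\<lambda>i. (i (Suc k), restrict i {1..k})" and i = "\<lambda>(j, g). g(Suc k := j)"])
    fix i assume i: "i \<in> index_chains n (Suc k) l"
    then show "(case (i (Suc k), restrict i {1..k}) of (j, g) \<Rightarrow> g(Suc k := j)) = i"
      by (auto simp: index_chains_def PiE_def extensional_def fun_eq_iff)
    have "i (Suc k) \<in> {l..n}"
      using i by (auto simp: index_chains_def PiE_def Pi_def)
    then show "(i (Suc k), restrict i {1..k}) \<in> Sigma {l..n} (index_chains n k)"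
      using restrict_mem_chains[OF i] by auto
    show "(case (i (Suc k), restrict i {1..k}) of (j, g) \<Rightarrow> ?y j * ?w k g) = ?w (Suc k) i"
      by (simp add: mult.commute)
  next
    fix p assume p: "p \<in> Sigma {l..n} (index_chains n k)"
    obtain j g where jg: "p = (j, g)" by (cases p)
    have g: "g \<in> index_chains n k j" "j \<in> {l..n}"
      using p jg by auto
    show "(case p of (j, g) \<Rightarrow> g(Suc k := j)) \<in> index_chains n (Suc k) l"
      using fun_upd_mem_chains[OF g Suc.prems] jg by simp
    show "((case p of (j, g) \<Rightarrow> g(Suc k := j)) (Suc k),
        restrict (case p of (j, g) \<Rightarrow> g(Suc k := j)) {1..k}) = p"
      using g jg by (auto simp: index_chains_def PiE_def extensional_def fun_eq_iff)
  qed
  also have "\<dots> = (\<Sum>j = l..n. ?y j * (\<Sum>g \<in> index_chains n k j. ?w k g))"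
    by (subst sum.Sigma[symmetric]) (auto simp: finite_chains sum_distrib_left)
  also have "\<dots> = S_tail n a x (Suc k) l"
    using Suc by (simp add: Suc.IH)
  finally show ?case .
qed

lemma S_sum_eq_S_tail: "S_sum k a x n = S_tail n a x k 1"
proof -
  have "{i \<in> {1..k} \<rightarrow>\<^sub>E {1..n}. \<forall>j\<in>{1..<k}. i (Suc j) \<le> i j} = index_chains n k 1"
    by (auto simp: index_chains_def PiE_def Pi_def)
  then show ?thesis
    using sum_chains[of 1 x a k n] by (simp add: S_sum_def)
qed

section \<open>Removable singularities, integrals and quotients of polynomials\<close>

text \<open>The limit of \<open>h\<close> at \<open>c\<close> sees only values off \<open>c\<close>,
  where \<open>h\<close> agrees with the continuous \<open>p\<close>.\<close>

lemma cont_ext_eq: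
  assumes "\<And>t. t \<noteq> c \<Longrightarrow> h t = p t" and "isCont p c"
  shows "cont_ext c h = p"
proof -
  have "(p \<longlongrightarrow> p c) (at c)"
    using assms(2) by (simp add: isCont_def)
  moreover have "eventually (\<lambda>t. p t = h t) (at c)"
    using assms(1) by (auto simp: eventually_at_filter)
  ultimately have "(h \<longlongrightarrow> p c) (at c)"
    using tendsto_cong by blast
  then have "Lim (at c) h = p c"
    by (intro tendsto_Lim) auto
  then show ?thesis
    using assms(1) by (auto simp: cont_ext_def)
qed

text \<open>Integrating \<open>y ^ (l - 1)\<close> gives the extra factor \<open>1 / l\<close> that
  turns \<open>r\<close> into \<open>Suc r\<close>; the fundamental theorem in this form covers both
  orientations.\<close>

lemma LBINT_poly:
  "(LBINT y=ereal u..ereal v. (\<Sum>l = 1..n. a l * y ^ (l - 1) / real l ^ r))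
     = (\<Sum>l = 1..n. a l * (v ^ l - u ^ l) / real l ^ Suc r)"
proof -
  let ?F = "\<lambda>y. \<Sum>l = 1..n. a l * y ^ l / real l ^ Suc r"
  have "(LBINT y=ereal u..ereal v. (\<Sum>l = 1..n. a l * y ^ (l - 1) / real l ^ r)) = ?F v - ?F u"
  proof (rule interval_integral_FTC_finite)
    show "continuous_on {min u v..max u v} (\<lambda>y. \<Sum>l = 1..n. a l * y ^ (l - 1) / real l ^ r)"
      by (intro continuous_intros) auto
  next
    fix y
    have "(?F has_real_derivative (\<Sum>l = 1..n. a l * y ^ (l - 1) / real l ^ r)) (at y)"
      by (rule DERIV_sum) (auto intro!: derivative_eq_intros simp: field_simps)
    then show "(?F has_vector_derivative (\<Sum>l = 1..n. a l * y ^ (l - 1) / real l ^ r))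
        (at y within {min u v..max u v})"
      using has_field_derivative_at_within has_real_derivative_iff_has_vector_derivative by blast
  qed
  then show ?thesis
    by (simp add: sum_subtractf right_diff_distrib diff_divide_distrib)
qed

lemma sum_triangle_swap:
  fixes g :: "nat \<Rightarrow> nat \<Rightarrow> 'a::comm_monoid_add"
  shows "(\<Sum>l = 1..n. \<Sum>j = 1..l. g l j) = (\<Sum>j = 1..n. \<Sum>l = j..n. g l j)"
proof -
  have "(\<Sum>l = 1..n. \<Sum>j = 1..l. g l j) = (\<Sum>l = 1..n. \<Sum>j\<in>{j\<in>{1..n}. j \<le> l}. g l j)"
    by (intro sum.cong) auto
  also have "\<dots> = (\<Sum>j = 1..n. \<Sum>l\<in>{l\<in>{1..n}. j \<le> l}. g l j)"
    by (rule sum.swap_restrict) auto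
  also have "\<dots> = (\<Sum>j = 1..n. \<Sum>l = j..n. g l j)"
    by (intro sum.cong) auto
  finally show ?thesis .
qed

text \<open>The geometric factorisation with \<open>j\<close> counted from 1, to match the powers
  \<open>t ^ (j - 1)\<close> of the integrands.\<close>

lemma power_diff_sum_1:
  fixes t c :: "'a::comm_ring_1"
  shows "t ^ l - c ^ l = (t - c) * (\<Sum>j = 1..l. t ^ (j - 1) * c ^ (l - j))"
proof (cases l)
  case (Suc q)
  have "(\<Sum>j = 1..Suc q. t ^ (j - 1) * c ^ (Suc q - j)) = (\<Sum>p<Suc q. t ^ p * c ^ (q - p))"
    by (rule sum.reindex_bij_witness[where i = Suc and j = "\<lambda>j. j - 1"]) auto
  then show ?thesis
    using Suc diff_power_eq_sum[of t q c] by simp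
qed simp

text \<open>Each \<open>t ^ l - c ^ l\<close> contributes a geometric sum over
  \<open>j \<le> l\<close>; exchanging the sums collects the coefficient of
  \<open>t ^ (j - 1)\<close> as a tail over \<open>l \<ge> j\<close>.\<close>

lemma poly_quotient:
  fixes a :: "nat \<Rightarrow> real"
  assumes "c \<noteq> 0" "t \<noteq> c"
  shows "(\<Sum>l = 1..n. a l * (t ^ l - c ^ l)) / (t - c)
           = (\<Sum>j = 1..n. (\<Sum>l = j..n. a l * c ^ l) / c ^ j * t ^ (j - 1))"
proof -
  have "(\<Sum>l = 1..n. a l * (t ^ l - c ^ l)) / (t - c)
      = (\<Sum>l = 1..n. \<Sum>j = 1..l. a l * (t ^ (j - 1) * c ^ (l - j)))"
    using assms by (simp add: power_diff_sum_1[of t _ c] sum_divide_distrib sum_distrib_left)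
  also have "\<dots> = (\<Sum>j = 1..n. \<Sum>l = j..n. a l * (t ^ (j - 1) * c ^ (l - j)))"
    by (rule sum_triangle_swap)
  \<comment> \<open>As \<open>c \<noteq> 0\<close> and \<open>j \<le> l\<close>,
    \<open>c ^ (l - j)\<close> is \<open>c ^ l / c ^ j\<close>.\<close>
  also have "\<dots> = (\<Sum>j = 1..n. (\<Sum>l = j..n. a l * c ^ l) / c ^ j * t ^ (j - 1))"
    unfolding sum_divide_distrib sum_distrib_right
    using assms by (intro sum.cong) (auto simp: power_diff)
  finally show ?thesis .
qed

section \<open>The integrands as explicit polynomials\<close>

lemma partial_prod_0: "partial_prod b 0 = 1"
  by (simp add: partial_prod_def)

lemma partial_prod_Suc: "partial_prod b (Suc i) = partial_prod b i * b (Suc i)"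
  by (simp add: partial_prod_def)

lemma partial_prod_nonzero: "(\<And>j. j \<in> {1..i} \<Longrightarrow> b j \<noteq> 0) \<Longrightarrow> partial_prod b i \<noteq> 0"
  by (simp add: partial_prod_def)

text \<open>Taking the mean from 0 to \<open>t\<close> has \<open>t ^ (l - 1)\<close> as an
  eigenfunction with eigenvalue \<open>1 / l\<close>.\<close>

lemma S_integrand_poly_step:
  assumes "S_integrand n m b (Suc i) (Suc 0)
      = (\<lambda>t. \<Sum>l = 1..n. a l * t ^ (l - 1))"
  shows "S_integrand n m b (Suc i) (Suc r)
      = (\<lambda>t. \<Sum>l = 1..n. a l * t ^ (l - 1) / real l ^ r)"
proof (induction r)
  case 0
  then show ?case using assms by simp
next
  case (Suc r)
  show ?case
    unfolding S_integrand.simps Suc.IH LBINT_poly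
  proof (rule cont_ext_eq)
    fix t :: real assume "t \<noteq> 0"
    then show "1 / t * (\<Sum>l = 1..n. a l * (t ^ l - 0 ^ l) / real l ^ Suc r)
        = (\<Sum>l = 1..n. a l * t ^ (l - 1) / real l ^ Suc r)"
      \<comment> \<open>Since \<open>l \<ge> 1\<close>, the lower limit contributes
        \<open>0 ^ l = 0\<close>.\<close>
      unfolding sum_distrib_left
      by (intro sum.cong) (auto simp: power_0_left power_diff)
  qed (intro continuous_intros, auto)
qed

lemma S_integrand_1_poly:
  assumes "n \<ge> 1" "\<And>j. j \<in> {1..i} \<Longrightarrow> b j \<noteq> 0" "\<And>j. j \<in> {1..i} \<Longrightarrow> m j \<ge> 1"
  shows "S_integrand n m b (Suc i) (Suc 0)
      = (\<lambda>t. \<Sum>l = 1..n. S_tail n m b i l / partial_prod b i ^ l * t ^ (l - 1))"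
  using assms(2,3)
proof (induction i)
  case 0
  show ?case
    unfolding S_integrand.simps
  proof (rule cont_ext_eq)
    fix t :: real assume "t \<noteq> partial_prod b 0"
    then show "S_outer n m b 0 t / (t - partial_prod b 0)
        = (\<Sum>l = 1..n. S_tail n m b 0 l / partial_prod b 0 ^ l * t ^ (l - 1))"
      \<comment> \<open>Both \<open>S_tail\<close> at 0 and the empty product are 1, so this is the
        plain geometric sum.\<close>
      using power_diff_sum_1[of t n 1] by (simp add: partial_prod_0)
  qed (intro continuous_intros, auto simp: partial_prod_0)
next
  case (Suc i)
  let ?B = "partial_prod b i" and ?B' = "partial_prod b (Suc i)"
  let ?a = "\<lambda>l. S_tail n m b i l / ?B ^ l"
  have B: "?B \<noteq> 0" "?B' \<noteq> 0"
    using Suc.prems by (auto intro!: partial_prod_nonzero)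
  obtain r where r: "m (Suc i) = Suc r"
    using Suc.prems(2)[of "Suc i"] by (cases "m (Suc i)") auto
  have IH: "S_integrand n m b (Suc i) (Suc 0) = (\<lambda>t. \<Sum>l = 1..n. ?a l * t ^ (l - 1))"
    using Suc by simp
  \<comment> \<open>Starting the integral at \<open>?B'\<close> makes every term a multiple of
    \<open>t ^ l - ?B' ^ l\<close>, hence divisible by \<open>t - ?B'\<close>.\<close>
  have G: "S_outer n m b (Suc i) t
      = (\<Sum>l = 1..n. ?a l / real l ^ m (Suc i) * (t ^ l - ?B' ^ l))" for t
    unfolding S_outer.simps r S_integrand_poly_step[OF IH] LBINT_poly by simp
  \<comment> \<open>The quotient \<open>?B' ^ l / ?B ^ l\<close> is \<open>b (Suc i) ^ l\<close>,
    which turns the tail into the recursion of \<open>S_tail\<close>.\<close>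
  have tail: "(\<Sum>l = j..n. ?a l / real l ^ m (Suc i) * ?B' ^ l) = S_tail n m b (Suc i) j" for j
    using B by (simp add: partial_prod_Suc power_mult_distrib ac_simps)
  show ?case
    unfolding S_integrand.simps(1)[of n m b "Suc i"] G
  proof (rule cont_ext_eq)
    fix t assume t: "t \<noteq> ?B'"
    show "(\<Sum>l = 1..n. ?a l / real l ^ m (Suc i) * (t ^ l - ?B' ^ l)) / (t - ?B')
        = (\<Sum>l = 1..n. S_tail n m b (Suc i) l / ?B' ^ l * t ^ (l - 1))"
      unfolding poly_quotient[OF B(2) t] tail ..
  qed (use B in \<open>auto intro!: continuous_intros\<close>)
qed

lemma S_sum_eq_LBINT:
  assumes "n \<ge> 1" "k \<ge> 1" "\<And>j. j \<in> {1..k} \<Longrightarrow> b j \<noteq> 0" "\<And>j. j \<in> {1..k} \<Longrightarrow> m j \<ge> 1"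
  shows "S_sum k m b n = (LBINT t=ereal 0..ereal (partial_prod b k). S_integrand n m b k (m k) t)"
proof -
  obtain i where i: "k = Suc i"
    using assms by (cases k) auto
  obtain r where r: "m (Suc i) = Suc r"
    using assms(4)[of "Suc i"] i by (cases "m (Suc i)") auto
  let ?B = "partial_prod b i"
  have B: "?B \<noteq> 0"
    using assms i by (auto intro!: partial_prod_nonzero)
  have 1: "S_integrand n m b (Suc i) (Suc 0)
      = (\<lambda>t. \<Sum>l = 1..n. S_tail n m b i l / ?B ^ l * t ^ (l - 1))"
    using assms i by (intro S_integrand_1_poly) auto
  have "(LBINT t=ereal 0..ereal (partial_prod b k). S_integrand n m b k (m k) t)
      = (\<Sum>l = 1..n. S_tail n m b i l / ?B ^ l * (partial_prod b k ^ l - 0 ^ l) / real l ^ m k)"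
    unfolding i r S_integrand_poly_step[OF 1] LBINT_poly by simp
  \<comment> \<open>The powers \<open>0 ^ l\<close> vanish, and
    \<open>partial_prod b k ^ l / ?B ^ l\<close> supplies the missing factor
    \<open>b k ^ l\<close>.\<close>
  also have "\<dots> = S_tail n m b k 1"
    using B unfolding i S_tail.simps
    by (intro sum.cong) (auto simp: partial_prod_Suc power_mult_distrib power_0_left)
  finally show ?thesis
    by (simp add: S_sum_eq_S_tail)
qed

section \<open>The iterated integral, block by block\<close>

lemma integral_block_Suc_0: "integral_block l c (Suc 0) = [(l, c)]"
  by (simp add: integral_block_def)

lemma integral_block_Suc_Suc:
  "integral_block l c (Suc (Suc r)) = (l, 0) # integral_block 0 c (Suc r)"
  by (simp add: integral_block_def)

text \<open>Within a block both recursions agree. The induction generalises \<open>l\<close> because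
  peeling off the outermost integration leaves a block with lower limit 0.\<close>

lemma nested_integral_block:
  assumes "nested_integral n ps = S_outer n m b i"
  shows "nested_integral n (integral_block l (partial_prod b i) (Suc r) @ ps) v
     = (LBINT x=ereal l..ereal v. S_integrand n m b (Suc i) (Suc r) x)"
proof (induction r arbitrary: l v)
  case 0
  show ?case by (simp add: integral_block_Suc_0 assms)
next
  case (Suc r)
  show ?case by (simp add: integral_block_Suc_Suc Suc.IH)
qed

text \<open>Here every block starts at its own \<open>partial_prod b i\<close>, as all blocks of
  \<open>S_blocks\<close> but the outermost do, so each performs one step of the recursion for
  \<open>S_outer\<close>.\<close>

lemma nested_integral_S_outer:
  assumes "\<And>j. j \<in> {1..i} \<Longrightarrow> m j \<ge> 1"
  shows "nested_integral n (concat (map (\<lambda>i. integral_block (partial_prod b i)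
           (partial_prod b (i - 1)) (m i)) (rev [1..<Suc i]))) = S_outer n m b i"
  using assms
proof (induction i)
  case 0
  show ?case by simp
next
  case (Suc i)
  obtain r where r: "m (Suc i) = Suc r"
    using Suc.prems[of "Suc i"] by (cases "m (Suc i)") auto
  have "nested_integral n (concat (map (\<lambda>i. integral_block (partial_prod b i)
           (partial_prod b (i - 1)) (m i)) (rev [1..<Suc i]))) = S_outer n m b i"
    using Suc by simp
  from nested_integral_block[OF this, of "partial_prod b (Suc i)" r] show ?case
    by (auto simp: r)
qed

lemma nested_integral_S_blocks:
  assumes "k \<ge> 1" "\<And>j. j \<in> {1..k} \<Longrightarrow> m j \<ge> 1"
  shows "nested_integral n (S_blocks k m b) v = (LBINT t=ereal 0..ereal v. S_integrand n m b k (m k) t)"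
proof -
  obtain i where i: "k = Suc i"
    using assms by (cases k) auto
  obtain r where r: "m (Suc i) = Suc r"
    using assms(2)[of "Suc i"] i by (cases "m (Suc i)") auto
  let ?ps = "concat (map (\<lambda>i. integral_block (partial_prod b i)
           (partial_prod b (i - 1)) (m i)) (rev [1..<Suc i]))"
  \<comment> \<open>Below the outermost block \<open>j \<le> i < k\<close>, so the exceptional lower
    limit 0 does not occur.\<close>
  have "map (\<lambda>j. integral_block (if j = k then 0 else partial_prod b j)
                        (partial_prod b (j - 1)) (m j)) (rev [1..<Suc i])
      = map (\<lambda>j. integral_block (partial_prod b j) (partial_prod b (j - 1)) (m j)) (rev [1..<Suc i])"
    using i by (intro map_cong) auto
  moreover have "rev [1..<Suc k] = k # rev [1..<Suc i]"
    using i by simp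
  ultimately have "S_blocks k m b = integral_block 0 (partial_prod b (k - 1)) (m k) @ ?ps"
    unfolding S_blocks_def by (simp only: list.map concat.simps simp_thms if_True)
  moreover have "nested_integral n ?ps = S_outer n m b i"
    using assms i by (intro nested_integral_S_outer) auto
  ultimately show ?thesis
    using nested_integral_block[of n ?ps m b i 0 r v] i r by simp
qed

theorem theorem3p4p3:
  fixes k n :: nat and m :: "nat \<Rightarrow> nat" and b :: "nat \<Rightarrow> real"
  assumes "k \<ge> 1" and "n \<ge> 1"
    and "\<And>i. i \<in> {1..k} \<Longrightarrow> m i \<ge> 1"
    and "\<And>i. i \<in> {1..k} \<Longrightarrow> b i \<noteq> 0"
  shows "S_sum k m b n =
           (LBINT t=ereal 0..ereal (partial_prod b k). S_integrand n m b k (m k) t)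
       \<and> S_sum k m b n = nested_integral n (S_blocks k m b) (partial_prod b k)"
  using S_sum_eq_LBINT[OF assms(2,1,4,3)] nested_integral_S_blocks[OF assms(1,3)] by simp

end
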